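(* Let $(M,\rho)$ be a hyperbolic manifold and let $K \le \pi_1(M)$ be a finite index subgroup with $[\pi_1(M):K] = C$. Let $(M',\rho')$ be the cover of $M$ of degree $C$ corresponding to the subgroup $K$ (with $\rho'$ the lifted metric). Then $\mathrm{F}_{M,\rho}(n) \le C\cdot \mathrm{F}_{M',\rho'}(n)$ for all $n$, and hence $\mathrm{F}_{M,\rho} \preceq \mathrm{F}_{M',\rho'}$.
   Context: A hyperbolic manifold $(M,\rho)$ is a connected manifold with a complete Riemannian metric $\rho$ of constant curvature $-1$. For $\alpha \in \pi_1(M)-\{1\}$, $\ell_\rho(\alpha)$ denotes the length of the unique geodesic representative of $\alpha$ in $(M,\rho)$, i.e. the translation length of $\alpha$ along its axis in the universal cover; only elements having a geodesic representative are considered. For a group $G$ and $g \in G-\{1\}$ the divisibility function is $D_G(g) = \min\{[G:H] : H \le G,\ g \notin H\} \in \mathbf{N}\cup\{\infty\}$. The geodesic residual finiteness function $\mathrm{F}_{M,\rho}(n)$ is the maximum (supremum, possibly $\infty$) of $D_{\pi_1(M)}(\alpha)$ over all $\alpha \in \pi_1(M)-\{1\}$ with $\ell_\rho(\alpha) \le n$ (this makes sense for any real $n>0$; the value is taken to be $1$ if there is no such $\alpha$). $\mathrm{F}_{M',\rho'}$ is defined in the same way, with $\pi_1(M') = K$. For functions $f,g$ on the positive integers (here both also defined at positive reals), $f \preceq g$ means there is a constant $c>0$ such that $f(n) \le c\, g(cn)$ for all $n$. *)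

theory Defs
  imports "HOL-Analysis.Analysis" "HOL-Algebra.Coset"
begin

section \<open>Smooth functions on open subsets of Euclidean space\<close>

definition pderiv_at :: "'n \<Rightarrow> (real ^ 'n::finite \<Rightarrow> 'b::real_normed_vector) \<Rightarrow> real ^ 'n \<Rightarrow> 'b" where
  "pderiv_at i f u = frechet_derivative f (at u) (axis i 1)"

fun Ck_on :: "nat \<Rightarrow> (real ^ 'n::finite) set \<Rightarrow> (real ^ 'n \<Rightarrow> 'b::real_normed_vector) \<Rightarrow> bool" where
  "Ck_on 0 S f \<longleftrightarrow> continuous_on S f"
| "Ck_on (Suc k) S f \<longleftrightarrow>
     (\<forall>u\<in>S. f differentiable (at u)) \<and> (\<forall>i. Ck_on k S (pderiv_at i f))"

definition smooth_on :: "(real ^ 'n::finite) set \<Rightarrow> (real ^ 'n \<Rightarrow> 'b::real_normed_vector) \<Rightarrow> bool" where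
  "smooth_on S f \<longleftrightarrow> (\<forall>k. Ck_on k S f)"


section \<open>Riemannian manifolds\<close>

text \<open>A chart carries its domain, its coordinate map, and the coefficient matrix of the Riemannian
  metric in these coordinates, as a function of the coordinates. A smooth atlas together with a
  Riemannian metric is a set of such charts with smooth transition maps along which the coefficient
  matrices transform as covariant 2-tensors.\<close>

datatype ('a, 'n::finite) rchart =
  RChart (cdom: "'a set") (cmap: "'a \<Rightarrow> real ^ 'n") (cmet: "real ^ 'n \<Rightarrow> real ^ 'n ^ 'n")

definition cinv :: "('a, 'n::finite) rchart \<Rightarrow> real ^ 'n \<Rightarrow> 'a" where
  "cinv c = inv_into (cdom c) (cmap c)"

definition gip :: "('a, 'n::finite) rchart \<Rightarrow> real ^ 'n \<Rightarrow> real ^ 'n \<Rightarrow> real ^ 'n \<Rightarrow> real" where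
  "gip c u v w = v \<bullet> (cmet c u *v w)"

definition riem_chart :: "'a::topological_space set \<Rightarrow> ('a, 'n::finite) rchart \<Rightarrow> bool" where
  "riem_chart M c \<longleftrightarrow>
     openin (top_of_set M) (cdom c) \<and>
     open (cmap c ` cdom c) \<and>
     homeomorphism (cdom c) (cmap c ` cdom c) (cmap c) (cinv c) \<and>
     smooth_on (cmap c ` cdom c) (cmet c) \<and>
     (\<forall>u \<in> cmap c ` cdom c. transpose (cmet c u) = cmet c u \<and> (\<forall>v. v \<noteq> 0 \<longrightarrow> 0 < gip c u v v))"

definition transition :: "('a, 'n::finite) rchart \<Rightarrow> ('a, 'n) rchart \<Rightarrow> real ^ 'n \<Rightarrow> real ^ 'n" where
  "transition c c' = cmap c' \<circ> cinv c"

definition riem_compatible :: "('a, 'n::finite) rchart \<Rightarrow> ('a, 'n) rchart \<Rightarrow> bool" where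
  "riem_compatible c c' \<longleftrightarrow>
     smooth_on (cmap c ` (cdom c \<inter> cdom c')) (transition c c') \<and>
     (\<forall>u \<in> cmap c ` (cdom c \<inter> cdom c'). \<forall>v w.
        gip c u v w = gip c' (transition c c' u)
                        (frechet_derivative (transition c c') (at u) v)
                        (frechet_derivative (transition c c') (at u) w))"

definition riem_manifold :: "'a::topological_space set \<Rightarrow> ('a, 'n::finite) rchart set \<Rightarrow> bool" where
  "riem_manifold M A \<longleftrightarrow>
     Hausdorff_space (top_of_set M) \<and> second_countable (top_of_set M) \<and>
     (\<Union>c\<in>A. cdom c) = M \<and>
     (\<forall>c\<in>A. riem_chart M c) \<and>
     (\<forall>c\<in>A. \<forall>c'\<in>A. riem_compatible c c')"


subsection \<open>Length, distance and completeness\<close>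

definition riem_speed :: "('a, 'n::finite) rchart set \<Rightarrow> (real \<Rightarrow> 'a) \<Rightarrow> real \<Rightarrow> real" where
  "riem_speed A \<gamma> t = (THE s. \<exists>c\<in>A. \<gamma> t \<in> cdom c \<and>
     s = sqrt (gip c (cmap c (\<gamma> t))
                 (vector_derivative (cmap c \<circ> \<gamma>) (at t)) (vector_derivative (cmap c \<circ> \<gamma>) (at t))))"

definition riem_length :: "('a, 'n::finite) rchart set \<Rightarrow> (real \<Rightarrow> 'a) \<Rightarrow> real" where
  "riem_length A \<gamma> = integral {0..1} (riem_speed A \<gamma>)"

definition C1_path :: "'a::topological_space set \<Rightarrow> ('a, 'n::finite) rchart set \<Rightarrow> (real \<Rightarrow> 'a) \<Rightarrow> bool" where
  "C1_path M A \<gamma> \<longleftrightarrow> path \<gamma> \<and> path_image \<gamma> \<subseteq> M \<and>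
     (\<forall>c\<in>A. (cmap c \<circ> \<gamma>) C1_differentiable_on {t \<in> {0..1}. \<gamma> t \<in> cdom c})"

text \<open>The velocity of a C1 path may vanish, so the corners of a piecewise C1 path can be
  reparametrised away and the infimum below is also the one over piecewise C1 paths.\<close>

definition riem_dist :: "'a::topological_space set \<Rightarrow> ('a, 'n::finite) rchart set \<Rightarrow> 'a \<Rightarrow> 'a \<Rightarrow> real" where
  "riem_dist M A x y =
     (if x \<in> M \<and> y \<in> M
      then Inf {riem_length A \<gamma> | \<gamma>. C1_path M A \<gamma> \<and> pathstart \<gamma> = x \<and> pathfinish \<gamma> = y}
      else 0)"

definition riem_complete :: "'a::topological_space set \<Rightarrow> ('a, 'n::finite) rchart set \<Rightarrow> bool" where
  "riem_complete M A \<longleftrightarrow> Metric_space.mcomplete M (riem_dist M A)"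


subsection \<open>Curvature\<close>

definition christoffel :: "('a, 'n::finite) rchart \<Rightarrow> 'n \<Rightarrow> 'n \<Rightarrow> 'n \<Rightarrow> real ^ 'n \<Rightarrow> real" where
  "christoffel c k i j u =
     (\<Sum>l\<in>UNIV. matrix_inv (cmet c u) $ k $ l *
        (pderiv_at i (\<lambda>u. cmet c u $ j $ l) u + pderiv_at j (\<lambda>u. cmet c u $ i $ l) u
          - pderiv_at l (\<lambda>u. cmet c u $ i $ j) u)) / 2"

text \<open>\<open>riem_tensor c l k i j\<close> is the component along the \<open>l\<close>-th coordinate field of
  \<open>R(\<partial>\<^sub>i, \<partial>\<^sub>j)\<partial>\<^sub>k\<close>, with the convention
  \<open>R(X, Y)Z = \<nabla>\<^sub>X\<nabla>\<^sub>Y Z - \<nabla>\<^sub>Y\<nabla>\<^sub>X Z - \<nabla>\<^bsub>[X, Y]\<^esub> Z\<close>.\<close>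

definition riem_tensor :: "('a, 'n::finite) rchart \<Rightarrow> 'n \<Rightarrow> 'n \<Rightarrow> 'n \<Rightarrow> 'n \<Rightarrow> real ^ 'n \<Rightarrow> real" where
  "riem_tensor c l k i j u =
     pderiv_at i (christoffel c l j k) u - pderiv_at j (christoffel c l i k) u
     + (\<Sum>m\<in>UNIV. christoffel c l i m u * christoffel c m j k u
                 - christoffel c l j m u * christoffel c m i k u)"

definition riem_op :: "('a, 'n::finite) rchart \<Rightarrow> real ^ 'n \<Rightarrow> real ^ 'n \<Rightarrow> real ^ 'n \<Rightarrow> real ^ 'n \<Rightarrow> real ^ 'n" where
  "riem_op c u v w z =
     (\<chi> l. \<Sum>i\<in>UNIV. \<Sum>j\<in>UNIV. \<Sum>k\<in>UNIV. riem_tensor c l k i j u * v $ i * w $ j * z $ k)"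

definition sectional_curvature :: "('a, 'n::finite) rchart \<Rightarrow> real ^ 'n \<Rightarrow> real ^ 'n \<Rightarrow> real ^ 'n \<Rightarrow> real" where
  "sectional_curvature c u v w =
     gip c u (riem_op c u v w w) v / (gip c u v v * gip c u w w - (gip c u v w)\<^sup>2)"

definition constant_curvature :: "('a, 'n::finite) rchart set \<Rightarrow> real \<Rightarrow> bool" where
  "constant_curvature A \<kappa> \<longleftrightarrow>
     (\<forall>c\<in>A. \<forall>u \<in> cmap c ` cdom c. \<forall>v w. v \<noteq> w \<and> independent {v, w} \<longrightarrow>
        sectional_curvature c u v w = \<kappa>)"

definition hyperbolic_manifold :: "'a::topological_space set \<Rightarrow> ('a, 'n::finite) rchart set \<Rightarrow> bool" where
  "hyperbolic_manifold M A \<longleftrightarrow>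
     M \<noteq> {} \<and> connected M \<and> riem_manifold M A \<and> riem_complete M A \<and> constant_curvature A (-1)"


subsection \<open>Closed geodesics\<close>

text \<open>The geodesic equation, in every chart. Since it is required at every time at which the curve
  is in the chart domain, the first derivative is defined near each such time.\<close>

definition geodesic :: "'a::topological_space set \<Rightarrow> ('a, 'n::finite) rchart set \<Rightarrow> (real \<Rightarrow> 'a) \<Rightarrow> bool" where
  "geodesic M A \<gamma> \<longleftrightarrow> continuous_on UNIV \<gamma> \<and> range \<gamma> \<subseteq> M \<and>
     (\<forall>c\<in>A. \<forall>t. \<gamma> t \<in> cdom c \<longrightarrow>
        (let x = cmap c \<circ> \<gamma>; x' = (\<lambda>s. vector_derivative x (at s)) in
          x differentiable (at t) \<and>
          (x' has_vector_derivative
             (\<chi> k. - (\<Sum>i\<in>UNIV. \<Sum>j\<in>UNIV. christoffel c k i j (x t) * x' t $ i * x' t $ j))) (at t)))"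

definition closed_geodesic :: "'a::topological_space set \<Rightarrow> ('a, 'n::finite) rchart set \<Rightarrow> (real \<Rightarrow> 'a) \<Rightarrow> bool" where
  "closed_geodesic M A \<gamma> \<longleftrightarrow> geodesic M A \<gamma> \<and> (\<forall>t. \<gamma> (t + 1) = \<gamma> t)"


subsection \<open>The Riemannian metric lifted along a covering\<close>

text \<open>The charts of the cover are the charts of the base composed with the covering map, on open sets
  that are mapped injectively into a chart domain; the metric coefficients are unchanged. This
  is the smooth structure and metric that make \<open>p\<close> a local isometry.\<close>

definition lifted_atlas ::
    "'b::topological_space set \<Rightarrow> ('b \<Rightarrow> 'a) \<Rightarrow> ('a, 'n::finite) rchart set \<Rightarrow> ('b, 'n) rchart set" where
  "lifted_atlas M' p A =
     {RChart V (cmap c \<circ> p) (cmet c) | V c.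
        c \<in> A \<and> openin (top_of_set M') V \<and> inj_on p V \<and> p ` V \<subseteq> cdom c}"


section \<open>The fundamental group\<close>

definition path_class :: "'a::topological_space set \<Rightarrow> (real \<Rightarrow> 'a) \<Rightarrow> (real \<Rightarrow> 'a) set" where
  "path_class M \<gamma> = Collect (homotopic_paths M \<gamma>)"

definition based_loops :: "'a::topological_space set \<Rightarrow> 'a \<Rightarrow> (real \<Rightarrow> 'a) set" where
  "based_loops M x = {\<gamma>. path \<gamma> \<and> path_image \<gamma> \<subseteq> M \<and> pathstart \<gamma> = x \<and> pathfinish \<gamma> = x}"

definition fundamental_group :: "'a::topological_space set \<Rightarrow> 'a \<Rightarrow> (real \<Rightarrow> 'a) set monoid" where
  "fundamental_group M x =
     \<lparr>carrier = path_class M ` based_loops M x,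
      mult = (\<lambda>\<alpha> \<beta>. \<Union>a\<in>\<alpha>. \<Union>b\<in>\<beta>. path_class M (a +++ b)),
      one = path_class M (\<lambda>_. x)\<rparr>"

definition induced_map ::
    "'a::topological_space set \<Rightarrow> ('b \<Rightarrow> 'a) \<Rightarrow> (real \<Rightarrow> 'b) set \<Rightarrow> (real \<Rightarrow> 'a) set" where
  "induced_map M p \<alpha> = (\<Union>a\<in>\<alpha>. path_class M (p \<circ> a))"


section \<open>Residual finiteness functions\<close>

definition subgroup_index :: "('g, 'm) monoid_scheme \<Rightarrow> 'g set \<Rightarrow> enat" where
  "subgroup_index G H =
     (if finite (rcosets\<^bsub>G\<^esub> H) then enat (card (rcosets\<^bsub>G\<^esub> H)) else \<infinity>)"

definition divisibility :: "('g, 'm) monoid_scheme \<Rightarrow> 'g \<Rightarrow> enat" where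
  "divisibility G g = (INF H \<in> {H. subgroup H G \<and> g \<notin> H}. subgroup_index G H)"

definition geodesic_rep ::
    "'a::topological_space set \<Rightarrow> ('a, 'n::finite) rchart set \<Rightarrow> (real \<Rightarrow> 'a) set \<Rightarrow> (real \<Rightarrow> 'a) \<Rightarrow> bool" where
  "geodesic_rep M A \<alpha> \<gamma> \<longleftrightarrow> closed_geodesic M A \<gamma> \<and> (\<exists>a\<in>\<alpha>. homotopic_loops M a \<gamma>)"

text \<open>In a hyperbolic manifold, the geodesic representative of a nontrivial class is unique up to the
  choice of its starting point, so its length is well defined.\<close>

definition geodesic_length ::
    "'a::topological_space set \<Rightarrow> ('a, 'n::finite) rchart set \<Rightarrow> (real \<Rightarrow> 'a) set \<Rightarrow> real" where
  "geodesic_length M A \<alpha> = (THE l. \<exists>\<gamma>. geodesic_rep M A \<alpha> \<gamma> \<and> l = riem_length A \<gamma>)"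

definition short_classes ::
    "'a::topological_space set \<Rightarrow> ('a, 'n::finite) rchart set \<Rightarrow> 'a \<Rightarrow> real \<Rightarrow> (real \<Rightarrow> 'a) set set" where
  "short_classes M A x n =
     {\<alpha> \<in> carrier (fundamental_group M x) - {\<one>\<^bsub>fundamental_group M x\<^esub>}.
        (\<exists>\<gamma>. geodesic_rep M A \<alpha> \<gamma>) \<and> geodesic_length M A \<alpha> \<le> n}"

definition geodesic_RF ::
    "'a::topological_space set \<Rightarrow> ('a, 'n::finite) rchart set \<Rightarrow> 'a \<Rightarrow> real \<Rightarrow> enat" where
  "geodesic_RF M A x n =
     (if short_classes M A x n = {} then 1
      else (SUP \<alpha> \<in> short_classes M A x n. divisibility (fundamental_group M x) \<alpha>))"

definition growth_le :: "(real \<Rightarrow> enat) \<Rightarrow> (real \<Rightarrow> enat) \<Rightarrow> bool" (infix \<open>\<preceq>\<close> 50) where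
  "f \<preceq> g \<longleftrightarrow> (\<exists>c::real. c > 0 \<and>
     (\<forall>n::nat. n > 0 \<longrightarrow> ereal_of_enat (f (real n)) \<le> ereal c * ereal_of_enat (g (c * real n))))"

end

theory Submission
  imports Defs
begin

text \<open>Let \<open>\<alpha>\<close> be a nontrivial class of length at most \<open>n\<close>. If \<open>\<alpha>\<close> lies outside \<open>K\<close>, then \<open>K\<close>
  itself, of index \<open>C\<close>, excludes it. Otherwise \<open>\<alpha> = p\<^sub>*\<beta>\<close>, and a subgroup \<open>N\<close> of the fundamental
  group of the cover that excludes \<open>\<beta>\<close> yields \<open>p\<^sub>*N\<close>, which excludes \<open>\<alpha>\<close> since \<open>p\<^sub>*\<close> is injective, and
  has index at most \<open>C\<close> times the index of \<open>N\<close>. It remains to see that \<open>\<beta>\<close> is as short as \<open>\<alpha>\<close>: by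
  homotopy lifting the geodesic representatives of \<open>\<beta>\<close> are exactly the lifts of those of \<open>\<alpha>\<close>, and
  \<open>p\<close> preserves lengths. Uniqueness of the representative is never needed, because both lengths are
  defined from the same set of numbers.\<close>


section \<open>Lifting homotopies to covering spaces\<close>


text \<open>All starting points \<open>z\<close> in \<open>B\<close> and all points \<open>e\<close>
  over \<open>h z\<close> are allowed, so that a lift over one set can be continued over a
  neighbouring set from whatever value it has reached.\<close>

definition liftable ::
    "'b::topological_space set \<Rightarrow> ('b \<Rightarrow> 'a) \<Rightarrow> ('c::topological_space \<Rightarrow> 'a) \<Rightarrow> 'c set \<Rightarrow> bool" where
  "liftable C p h B \<longleftrightarrow> (\<forall>z\<in>B. \<forall>e\<in>C. p e = h z \<longrightarrow>
     (\<exists>k. continuous_on B k \<and> k ` B \<subseteq> C \<and> (\<forall>w\<in>B. p (k w) = h w) \<and> k z = e))"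

text \<open>Near each point of \<open>T\<close> the two lifts either agree throughout or differ
  throughout, because each stays in a single sheet over an evenly covered set. Hence the set of
  agreement is open and closed in \<open>T\<close>, and it contains \<open>a\<close>.\<close>

lemma covering_lift_unique:
  fixes C :: "'b::topological_space set" and S :: "'a::topological_space set"
    and f g :: "'c::topological_space \<Rightarrow> 'b"
  assumes cov: "covering_space C p S" and "connected T"
    and f: "continuous_on T f" "f ` T \<subseteq> C" and g: "continuous_on T g" "g ` T \<subseteq> C"
    and eq: "\<And>x. x \<in> T \<Longrightarrow> p (f x) = p (g x)"
    and "a \<in> T" "f a = g a" "x \<in> T"
  shows "f x = g x"
proof -
  have nbhd: "\<exists>V. openin (top_of_set T) V \<and> z \<in> V \<and> (\<forall>y\<in>V. f y = g y \<longleftrightarrow> f z = g z)"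
    if "z \<in> T" for z
  proof -
    have "p (f z) \<in> S"
      using cov f(2) that covering_space_imp_surjective by blast
    then obtain U \<V> where U: "p (f z) \<in> U" "\<Union>\<V> = C \<inter> p -` U"
      and ope: "\<And>V. V \<in> \<V> \<Longrightarrow> openin (top_of_set C) V" and disj: "pairwise disjnt \<V>"
      and hom: "\<And>V. V \<in> \<V> \<Longrightarrow> \<exists>q. homeomorphism V U p q"
      using cov unfolding covering_space_def by metis
    have "f z \<in> \<Union>\<V>" "g z \<in> \<Union>\<V>"
      using U f(2) g(2) eq that by auto
    then obtain V W where VW: "V \<in> \<V>" "f z \<in> V" "W \<in> \<V>" "g z \<in> W"
      by blast
    have inj: "inj_on p V"
      using hom[OF VW(1)] unfolding homeomorphism_def by (metis inj_onI)
    define N where "N = (T \<inter> f -` V) \<inter> (T \<inter> g -` W)"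
    have "openin (top_of_set T) N"
      unfolding N_def using ope VW f g
      by (intro openin_Int continuous_openin_preimage[where T = C]) auto
    moreover have "z \<in> N"
      using that VW by (simp add: N_def)
    \<comment> \<open>If both lifts run in the same sheet, injectivity of \<open>p\<close> there
      forces agreement on all of \<open>N\<close>; distinct sheets are disjoint and exclude it on
      all of \<open>N\<close>.\<close>
    moreover have "f y = g y \<longleftrightarrow> f z = g z" if "y \<in> N" for y
    proof (cases "V = W")
      case True
      then show ?thesis
        using that VW inj eq \<open>z \<in> T\<close> unfolding N_def inj_on_def by blast
    next
      case False
      then have "V \<inter> W = {}"
        using disj VW unfolding pairwise_def disjnt_def by blast
      then show ?thesis
        using that VW unfolding N_def by auto
    qed
    ultimately show ?thesis by blast
  qed
  have "openin (top_of_set T) {y \<in> T. (f y = g y) = b}" for b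
  proof (subst openin_subopen, intro ballI)
    fix z assume z: "z \<in> {y \<in> T. (f y = g y) = b}"
    then obtain V where V: "openin (top_of_set T) V" "z \<in> V" "\<forall>y\<in>V. f y = g y \<longleftrightarrow> f z = g z"
      using nbhd by blast
    have "y \<in> {y \<in> T. (f y = g y) = b}" if "y \<in> V" for y
      using openin_imp_subset[OF V(1)] z bspec[OF V(3) that] that by auto
    then show "\<exists>V. openin (top_of_set T) V \<and> z \<in> V \<and> V \<subseteq> {y \<in> T. (f y = g y) = b}"
      using V(1,2) by (intro exI[of _ V]) auto
  qed
  from this[of True] this[of False]
  have "openin (top_of_set T) {y \<in> T. f y = g y}" "openin (top_of_set T) {y \<in> T. f y \<noteq> g y}"
    by simp_all
  moreover have "{y \<in> T. f y = g y} \<inter> {y \<in> T. f y \<noteq> g y} = {}"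
    "T \<subseteq> {y \<in> T. f y = g y} \<union> {y \<in> T. f y \<noteq> g y}" by auto
  ultimately have "{y \<in> T. f y \<noteq> g y} = {}"
    using \<open>connected T\<close> \<open>a \<in> T\<close> \<open>f a = g a\<close> unfolding connected_openin by blast
  then show ?thesis using \<open>x \<in> T\<close> by blast
qed

text \<open>Lift over one set, then over the other starting from the value at a common point. By
  uniqueness the two lifts agree on the connected intersection, and closedness of both sets makes
  the glued map continuous.\<close>

lemma liftable_union:
  fixes C :: "'b::topological_space set" and S :: "'a::topological_space set"
    and h :: "'c::topological_space \<Rightarrow> 'a"
  assumes cov: "covering_space C p S" and A: "liftable C p h A" "closed A"
    and B: "liftable C p h B" "closed B" and AB: "connected (A \<inter> B)" "A \<inter> B \<noteq> {}"
  shows "liftable C p h (A \<union> B)"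
proof -
  \<comment> \<open>The starting point is taken in \<open>A\<close>; exchanging the two sets gives
    the other case.\<close>
  have *: "\<exists>k. continuous_on (A \<union> B) k \<and> k ` (A \<union> B) \<subseteq> C \<and> (\<forall>w\<in>A \<union> B. p (k w) = h w) \<and> k z = e"
    if A: "liftable C p h A" "closed A" and B: "liftable C p h B" "closed B"
      and AB: "connected (A \<inter> B)" "A \<inter> B \<noteq> {}" and z: "z \<in> A" "e \<in> C" "p e = h z" for A B z e
  proof -
    obtain k where k: "continuous_on A k" "k ` A \<subseteq> C" "\<And>w. w \<in> A \<Longrightarrow> p (k w) = h w" "k z = e"
      using A z unfolding liftable_def by metis
    obtain y where y: "y \<in> A" "y \<in> B" using AB by blast
    then have "k y \<in> C" "p (k y) = h y" using k by auto
    then obtain l where l: "continuous_on B l" "l ` B \<subseteq> C" "\<And>w. w \<in> B \<Longrightarrow> p (l w) = h w" "l y = k y"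
      using B y unfolding liftable_def by metis
    have agree: "k w = l w" if "w \<in> A \<inter> B" for w
      by (rule covering_lift_unique[OF cov AB(1), where a = y])
        (use k l y that in \<open>auto intro: continuous_on_subset\<close>)
    have "continuous_on (A \<union> B) (\<lambda>w. if w \<in> A then k w else l w)"
      by (rule continuous_on_cases) (use A B k l agree in auto)
    moreover have "(\<lambda>w. if w \<in> A then k w else l w) ` (A \<union> B) \<subseteq> C"
      using k l by auto
    ultimately show ?thesis
      using k l z by (intro exI[of _ "\<lambda>w. if w \<in> A then k w else l w"]) auto
  qed
  show ?thesis
    unfolding liftable_def using *[OF A B AB] *[OF B A] AB by (metis Int_commute Un_commute UnE)
qed

text \<open>The lift is \<open>h\<close> followed by the inverse of \<open>p\<close> on the sheet
  that contains the prescribed value \<open>e\<close>.\<close>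

lemma liftable_evenly_covered:
  assumes U: "\<Union>\<V> = C \<inter> p -` U" and hom: "\<And>V. V \<in> \<V> \<Longrightarrow> \<exists>q. homeomorphism V U p q"
    and h: "continuous_on B h" "h ` B \<subseteq> U"
  shows "liftable C p h B"
  unfolding liftable_def
proof (intro ballI impI)
  fix z e assume z: "z \<in> B" "e \<in> C" "p e = h z"
  then obtain V where V: "V \<in> \<V>" "e \<in> V" using U h by blast
  then obtain q where q: "homeomorphism V U p q" using hom by blast
  have "V \<subseteq> C" using U V by blast
  show "\<exists>k. continuous_on B k \<and> k ` B \<subseteq> C \<and> (\<forall>w\<in>B. p (k w) = h w) \<and> k z = e"
  proof (intro exI conjI ballI)
    show "continuous_on B (q \<circ> h)"
      using q h unfolding homeomorphism_def by (meson continuous_on_compose continuous_on_subset)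
    show "(q \<circ> h) ` B \<subseteq> C"
      using q h \<open>V \<subseteq> C\<close> unfolding homeomorphism_def by fastforce
    show "p ((q \<circ> h) w) = h w" if "w \<in> B" for w
      using q h that unfolding homeomorphism_def by auto
    show "(q \<circ> h) z = e"
      using q V z unfolding homeomorphism_def by (metis comp_apply)
  qed
qed

text \<open>Subdivision of the rectangle: first across a thin vertical strip, then along its length.\<close>

lemma liftable_rectangle:
  fixes C :: "'b::topological_space set" and S :: "'a::topological_space set"
    and h :: "real \<times> real \<Rightarrow> 'a"
  assumes cov: "covering_space C p S" and h: "continuous_on UNIV h" "range h \<subseteq> S"
    and "a \<le> b" "c \<le> d"
  shows "liftable C p h ({a..b} \<times> {c..d})"
proof -
  \<comment> \<open>The width depends on \<open>s\<close> but must serve the whole height. Under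
    \<open>Bolzano\<close>, two stacked pieces are joined by taking the smaller of their
    widths.\<close>
  have strip: "\<exists>\<delta>>0. \<forall>a b. a \<le> s \<and> s \<le> b \<and> b - a < \<delta> \<longrightarrow> liftable C p h ({a..b} \<times> {c..d})" for s
    using \<open>c \<le> d\<close>
  proof (induction c d rule: Bolzano)
    case (trans c d e)
    then obtain \<delta>1 \<delta>2 where d: "\<delta>1 > 0" "\<delta>2 > 0"
      "\<And>a b. a \<le> s \<Longrightarrow> s \<le> b \<Longrightarrow> b - a < \<delta>1 \<Longrightarrow> liftable C p h ({a..b} \<times> {c..d})"
      "\<And>a b. a \<le> s \<Longrightarrow> s \<le> b \<Longrightarrow> b - a < \<delta>2 \<Longrightarrow> liftable C p h ({a..b} \<times> {d..e})"
      by metis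
    have "liftable C p h ({a..b} \<times> {c..e})" if "a \<le> s" "s \<le> b" "b - a < min \<delta>1 \<delta>2" for a b
    proof -
      have un: "{a..b} \<times> {c..e} = ({a..b} \<times> {c..d}) \<union> ({a..b} \<times> {d..e})"
        using trans by auto
      \<comment> \<open>The two rectangles share a horizontal segment, which is connected, and
        nonempty because \<open>a \<le> s \<le> b\<close>.\<close>
      have int: "({a..b} \<times> {c..d}) \<inter> ({a..b} \<times> {d..e}) = {a..b} \<times> {d}"
        using trans by auto
      show ?thesis
        unfolding un
      proof (rule liftable_union[OF cov])
        show "({a..b} \<times> {c..d}) \<inter> ({a..b} \<times> {d..e}) \<noteq> {}"
          unfolding int using that by simp
        show "connected (({a..b} \<times> {c..d}) \<inter> ({a..b} \<times> {d..e}))"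
          unfolding int by (intro connected_Times) auto
      qed (use d that in \<open>auto intro: closed_Times\<close>)
    qed
    then show ?case using d by (intro exI[of _ "min \<delta>1 \<delta>2"]) auto
  next
    case (local t)
    have "h (s, t) \<in> S" using h by auto
    then obtain U \<V> where U: "h (s, t) \<in> U" "openin (top_of_set S) U" "\<Union>\<V> = C \<inter> p -` U"
      and hom: "\<And>V. V \<in> \<V> \<Longrightarrow> \<exists>q. homeomorphism V U p q"
      using cov unfolding covering_space_def by metis
    have "open (h -` U)"
      using continuous_openin_preimage[OF h(1), of S U] h(2) U by auto
    moreover have "(s, t) \<in> h -` U" using U(1) by simp
    \<comment> \<open>A product neighbourhood of \<open>(s, t)\<close> over one evenly covered set:
      every small rectangle around the point lies inside it.\<close>
    ultimately obtain A B where AB: "open A" "open B" "s \<in> A" "t \<in> B" "A \<times> B \<subseteq> h -` U"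
      using open_prod_elim[of "h -` U" "(s, t)"] by (metis mem_Sigma_iff)
    then obtain \<delta> \<epsilon> where de: "\<delta> > 0" "\<epsilon> > 0" "ball s \<delta> \<subseteq> A" "ball t \<epsilon> \<subseteq> B"
      by (meson open_contains_ball)
    have "liftable C p h ({a..b} \<times> {c..d})"
      if "a \<le> s" "s \<le> b" "b - a < \<delta>" "c \<le> t" "t \<le> d" "d - c < \<epsilon>" for a b c d
    proof (rule liftable_evenly_covered[OF U(3) hom])
      have "{a..b} \<subseteq> A" "{c..d} \<subseteq> B"
        using that de by (auto simp: dist_real_def subset_iff)
      then show "h ` ({a..b} \<times> {c..d}) \<subseteq> U" using AB by blast
    qed (use h in \<open>auto intro: continuous_on_subset\<close>)
    then show ?case using de by metis
  qed
  \<comment> \<open>The second bisection runs horizontally, with the thin strips as its local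
    case.\<close>
  from \<open>a \<le> b\<close> show ?thesis
  proof (induction a b rule: Bolzano)
    case (trans a b e)
    have un: "{a..e} \<times> {c..d} = ({a..b} \<times> {c..d}) \<union> ({b..e} \<times> {c..d})"
      using trans by auto
    have int: "({a..b} \<times> {c..d}) \<inter> ({b..e} \<times> {c..d}) = {b} \<times> {c..d}"
      using trans by auto
    show ?case
      unfolding un
    proof (rule liftable_union[OF cov])
      show "({a..b} \<times> {c..d}) \<inter> ({b..e} \<times> {c..d}) \<noteq> {}"
        unfolding int using \<open>c \<le> d\<close> by simp
      show "connected (({a..b} \<times> {c..d}) \<inter> ({b..e} \<times> {c..d}))"
        unfolding int by (intro connected_Times) auto
    qed (use trans in \<open>auto intro: closed_Times\<close>)
  qed (rule strip)
qed

lemma covering_lift_square: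
  fixes C :: "'b::topological_space set" and S :: "'a::topological_space set"
    and h :: "real \<times> real \<Rightarrow> 'a"
  assumes cov: "covering_space C p S" and h: "continuous_on ({0..1} \<times> {0..1}) h" "h \<in> {0..1} \<times> {0..1} \<rightarrow> S"
    and e: "e \<in> C" "p e = h (0, 0)"
  obtains k where "continuous_on ({0..1} \<times> {0..1}) k" "k ` ({0..1} \<times> {0..1}) \<subseteq> C"
    "\<And>w. w \<in> {0..1} \<times> {0..1} \<Longrightarrow> p (k w) = h w" "k (0, 0) = e"
proof -
  \<comment> \<open>clamping the coordinates extends the map to the whole plane\<close>
  define c :: "real \<Rightarrow> real" where "c t = max 0 (min 1 t)" for t
  define g where "g = h \<circ> (\<lambda>w. (c (fst w), c (snd w)))"
  have cim: "(\<lambda>w. (c (fst w), c (snd w))) ` A \<subseteq> {0..1} \<times> {0..1}" for A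
    by (auto simp: c_def)
  have "continuous_on UNIV (\<lambda>w. (c (fst w), c (snd w)))"
    unfolding c_def by (intro continuous_intros)
  then have "continuous_on UNIV g"
    unfolding g_def by (rule continuous_on_compose[OF _ continuous_on_subset[OF h(1) cim]])
  moreover have "range g \<subseteq> S"
    using h(2) by (auto simp: g_def c_def Pi_iff)
  ultimately have lift: "liftable C p g ({0..1} \<times> {0..1})"
    by (intro liftable_rectangle[OF cov]) auto
  have gh: "g w = h w" if "w \<in> {0..1} \<times> {0..1}" for w
    using that by (auto simp: g_def c_def)
  show ?thesis
    using lift[unfolded liftable_def, rule_format, of "(0,0)" e] e gh that by auto
qed

text \<open>Lift the square from \<open>a 0\<close>. The left edge of this lift and \<open>a\<close>
  itself both lift the same path from the same point, so they coincide. The first coordinate is the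
  homotopy parameter.\<close>

lemma covering_lift_homotopy:
  fixes C :: "'b::topological_space set" and S :: "'a::topological_space set"
    and h :: "real \<times> real \<Rightarrow> 'a"
  assumes cov: "covering_space C p S"
    and h: "continuous_on ({0..1} \<times> {0..1}) h" "h \<in> {0..1} \<times> {0..1} \<rightarrow> S"
    and a: "path a" "path_image a \<subseteq> C" and h0: "\<And>t. t \<in> {0..1} \<Longrightarrow> h (0, t) = p (a t)"
  obtains k where "continuous_on ({0..1} \<times> {0..1}) k"
    "\<forall>s\<in>{0..1}. \<forall>t\<in>{0..1}. k (s, t) \<in> C \<and> p (k (s, t)) = h (s, t)"
    "\<forall>s\<in>{0..1}. continuous_on {0..1} (\<lambda>t. k (s, t)) \<and> continuous_on {0..1} (\<lambda>t. k (t, s))"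
    "\<forall>t\<in>{0..1}. k (0, t) = a t"
proof -
  have aC: "a ` {0..1} \<subseteq> C" "continuous_on {0..1} a"
    using a by (auto simp: path_image_def path_def)
  have "a 0 \<in> C" "p (a 0) = h (0, 0)"
    using aC h0[of 0] by auto
  then obtain k where k: "continuous_on ({0..1} \<times> {0..1}) k" "k ` ({0..1} \<times> {0..1}) \<subseteq> C"
    "\<And>w. w \<in> {0..1} \<times> {0..1} \<Longrightarrow> p (k w) = h w" "k (0, 0) = a 0"
    using covering_lift_square[OF cov h] by blast
  have ck: "continuous_on {0..1} (\<lambda>t. k (s, t))" "continuous_on {0..1} (\<lambda>t. k (t, s))" if "s \<in> {0..1}" for s
    using that by (auto intro!: continuous_on_compose2[OF k(1)] continuous_intros)
  have kC: "k (s, t) \<in> C" "p (k (s, t)) = h (s, t)" if "s \<in> {0..1}" "t \<in> {0..1}" for s t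
    using k(2,3) that by auto
  have left: "k (0, t) = a t" if "t \<in> {0..1}" for t
    by (rule covering_lift_unique[OF cov, of "{0..1}" "\<lambda>t. k (0, t)" a 0])
      (use aC k(4) h0 ck kC that in auto)
  show ?thesis
    using that k(1) kC ck left by blast
qed

text \<open>In the lifted square the edges traced by the end points lie over constant paths, so they
  are constant. The right edge is then a lift of \<open>p \<circ> b\<close> that starts at
  \<open>a 0 = b 0\<close>, hence it is \<open>b\<close>; equality of the final points comes out as
  a consequence.\<close>

lemma covering_lift_homotopic_paths:
  fixes C :: "'b::topological_space set" and S :: "'a::topological_space set"
  assumes cov: "covering_space C p S" and hom: "homotopic_paths S (p \<circ> a) (p \<circ> b)"
    and a: "path a" "path_image a \<subseteq> C" and b: "path b" "path_image b \<subseteq> C"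
    and ab: "pathstart a = pathstart b"
  shows "homotopic_paths C a b"
proof -
  obtain h :: "real \<times> real \<Rightarrow> 'a" where h: "continuous_on ({0..1} \<times> {0..1}) h" "h \<in> {0..1} \<times> {0..1} \<rightarrow> S"
    and hh: "\<forall>t\<in>{0..1}. h (0, t) = (p \<circ> a) t" "\<forall>t\<in>{0..1}. h (1, t) = (p \<circ> b) t"
      "\<forall>s\<in>{0..1}. pathstart (h \<circ> Pair s) = pathstart (p \<circ> a) \<and> pathfinish (h \<circ> Pair s) = pathfinish (p \<circ> a)"
    using hom unfolding homotopic_paths by blast
  have h0: "h (0, t) = p (a t)" and h1: "h (1, t) = p (b t)" and hs: "h (t, 0) = p (a 0) \<and> h (t, 1) = p (a 1)"
    if "t \<in> {0..1}" for t
    using hh that by (auto simp: pathstart_def pathfinish_def)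
  have bC: "b ` {0..1} \<subseteq> C" "continuous_on {0..1} b" and a01: "a 0 \<in> C" "a 1 \<in> C"
    using a b by (auto simp: path_image_def path_def)
  obtain k where k: "continuous_on ({0..1} \<times> {0..1}) k"
    and kC: "\<forall>s\<in>{0..1}. \<forall>t\<in>{0..1}. k (s, t) \<in> C \<and> p (k (s, t)) = h (s, t)"
    and ck: "\<forall>s\<in>{0..1}. continuous_on {0..1} (\<lambda>t. k (s, t)) \<and> continuous_on {0..1} (\<lambda>t. k (t, s))"
    and left: "\<forall>t\<in>{0..1}. k (0, t) = a t"
    using covering_lift_homotopy[OF cov h a h0] by blast
  have bottom: "k (s, 0) = a 0" if "s \<in> {0..1}" for s
    by (rule covering_lift_unique[OF cov, of "{0..1}" "\<lambda>s. k (s, 0)" "\<lambda>_. a 0" 0])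
      (use a01 hs ck kC left that in auto)
  have top: "k (s, 1) = a 1" if "s \<in> {0..1}" for s
    by (rule covering_lift_unique[OF cov, of "{0..1}" "\<lambda>s. k (s, 1)" "\<lambda>_. a 1" 0])
      (use a01 hs ck kC left that in auto)
  have right: "k (1, t) = b t" if "t \<in> {0..1}" for t
    by (rule covering_lift_unique[OF cov, of "{0..1}" "\<lambda>t. k (1, t)" b 0])
      (use bC h1 ck kC bottom ab that in \<open>auto simp: pathstart_def\<close>)
  show ?thesis
    unfolding homotopic_paths
    by (intro exI[of _ k] conjI ballI)
      (use k kC left right bottom top in \<open>auto simp: pathstart_def pathfinish_def\<close>)
qed

text \<open>During a free homotopy the base point moves, but both ends of each stage follow the same
  path in \<open>S\<close>. Their lifts start at the same point since \<open>a\<close> is closed, so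
  every stage of the lifted homotopy is closed.\<close>

lemma covering_lift_homotopic_loops:
  fixes C :: "'b::topological_space set" and S :: "'a::topological_space set"
  assumes cov: "covering_space C p S" and hom: "homotopic_loops S (p \<circ> a) \<gamma>"
    and a: "path a" "path_image a \<subseteq> C" "pathfinish a = pathstart a"
  obtains \<gamma>' where "homotopic_loops C a \<gamma>'" "\<And>t. t \<in> {0..1} \<Longrightarrow> p (\<gamma>' t) = \<gamma> t"
proof -
  obtain h :: "real \<times> real \<Rightarrow> 'a" where h: "continuous_on ({0..1} \<times> {0..1}) h" "h \<in> {0..1} \<times> {0..1} \<rightarrow> S"
    and hh: "\<forall>t\<in>{0..1}. h (0, t) = (p \<circ> a) t" "\<forall>t\<in>{0..1}. h (1, t) = \<gamma> t"
      "\<forall>s\<in>{0..1}. pathfinish (h \<circ> Pair s) = pathstart (h \<circ> Pair s)"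
    using hom unfolding homotopic_loops by blast
  have h0: "h (0, t) = p (a t)" and h1: "h (1, t) = \<gamma> t" and hs: "h (t, 1) = h (t, 0)"
    if "t \<in> {0..1}" for t
    using hh that by (auto simp: pathstart_def pathfinish_def)
  obtain k where k: "continuous_on ({0..1} \<times> {0..1}) k"
    and kC: "\<forall>s\<in>{0..1}. \<forall>t\<in>{0..1}. k (s, t) \<in> C \<and> p (k (s, t)) = h (s, t)"
    and ck: "\<forall>s\<in>{0..1}. continuous_on {0..1} (\<lambda>t. k (s, t)) \<and> continuous_on {0..1} (\<lambda>t. k (t, s))"
    and left: "\<forall>t\<in>{0..1}. k (0, t) = a t"
    using covering_lift_homotopy[OF cov h a(1,2) h0] by blast
  have closed: "k (s, 1) = k (s, 0)" if "s \<in> {0..1}" for s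
    by (rule covering_lift_unique[OF cov, of "{0..1}" "\<lambda>s. k (s, 1)" "\<lambda>s. k (s, 0)" 0])
      (use a hs ck kC left that in \<open>auto simp: pathstart_def pathfinish_def\<close>)
  show ?thesis
  proof
    show "homotopic_loops C a (\<lambda>t. k (1, t))"
      unfolding homotopic_loops
      by (intro exI[of _ k] conjI ballI)
        (use k kC left closed in \<open>auto simp: pathstart_def pathfinish_def\<close>)
    show "p (k (1, t)) = \<gamma> t" if "t \<in> {0..1}" for t
      using kC h1 that by auto
  qed
qed


section \<open>Fundamental groups and indices of subgroups\<close>


text \<open>Interpolate linearly between the parameter changes \<open>f\<close> and \<open>g\<close>
  inside the unit interval and compose with \<open>a\<close>. This gives the unit and inverse laws
  of the fundamental group without calculations in the space itself.\<close>

lemma homotopic_paths_reparametrizations: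
  fixes a :: "real \<Rightarrow> 'a::topological_space"
  assumes a: "path a" "path_image a \<subseteq> S"
    and f: "continuous_on {0..1} f" "f ` {0..1} \<subseteq> {0..1}"
    and g: "continuous_on {0..1} g" "g ` {0..1} \<subseteq> {0..1}"
    and "f 0 = g 0" "f 1 = g 1"
    and b: "\<And>t. t \<in> {0..1} \<Longrightarrow> b t = a (f t)" and c: "\<And>t. t \<in> {0..1} \<Longrightarrow> c t = a (g t)"
  shows "homotopic_paths S b c"
proof -
  define k where "k w = (1 - fst w) * f (snd w) + fst w * g (snd w)" for w
  have k01: "k ` ({0..1} \<times> {0..1}) \<subseteq> {0..1}"
  proof (clarsimp simp: k_def image_subset_iff)
    fix s t :: real assume "0 \<le> s" "s \<le> 1" "0 \<le> t" "t \<le> 1"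
    moreover from this have "0 \<le> f t" "f t \<le> 1" "0 \<le> g t" "g t \<le> 1"
      using f(2) g(2) by (auto simp: image_subset_iff)
    ultimately show "0 \<le> (1 - s) * f t + s * g t \<and> (1 - s) * f t + s * g t \<le> 1"
      by (auto intro!: convex_bound_le)
  qed
  have "continuous_on ({0..1} \<times> {0..1}) k"
    unfolding k_def
    by (intro continuous_intros continuous_on_compose2[OF f(1)] continuous_on_compose2[OF g(1)]) auto
  moreover have "continuous_on {0..1} a" "a ` {0..1} \<subseteq> S"
    using a by (auto simp: path_def path_image_def)
  ultimately have "continuous_on ({0..1} \<times> {0..1}) (a \<circ> k)" "(a \<circ> k) ` ({0..1} \<times> {0..1}) \<subseteq> S"
    using k01 by (blast intro: continuous_on_compose continuous_on_subset, force)
  then show ?thesis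
    unfolding homotopic_paths image_subset_iff_funcset
    using assms(7,8) b c
    by (intro exI[of _ "a \<circ> k"])
      (auto simp: k_def pathstart_def pathfinish_def algebra_simps)
qed

lemma homotopic_paths_const_left:
  fixes a :: "real \<Rightarrow> 'a::topological_space"
  assumes a: "path a" "path_image a \<subseteq> S"
  shows "homotopic_paths S ((\<lambda>_. pathstart a) +++ a) a"
  by (rule homotopic_paths_reparametrizations[OF a, of "\<lambda>t. max (2 * t - 1) 0" "\<lambda>t. t"])
    (auto simp: joinpaths_def pathstart_def intro!: continuous_intros)

lemma homotopic_paths_reversepath_const:
  fixes a :: "real \<Rightarrow> 'a::topological_space"
  assumes a: "path a" "path_image a \<subseteq> S"
  shows "homotopic_paths S (reversepath a +++ a) (\<lambda>_. pathfinish a)"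
\<comment> \<open>The path back and forth is \<open>a\<close> with its parameter running from 1 down
  to 0 and up again; the constant path is \<open>a\<close> with its parameter held at 1.\<close>
proof (rule homotopic_paths_reparametrizations[OF a, of "\<lambda>t. \<bar>2 * t - 1\<bar>" "\<lambda>_. 1"])
  show "(reversepath a +++ a) t = a \<bar>2 * t - 1\<bar>" for t
    by (cases "t \<le> 1/2") (simp_all add: joinpaths_def reversepath_def abs_of_nonpos)
qed (auto simp: pathfinish_def intro!: continuous_intros)

text \<open>The hypotheses make \<open>a\<close> a member of its own class; otherwise the class
  would be empty, and equality of classes would say nothing.\<close>

lemma path_class_eq:
  assumes "path a" "path_image a \<subseteq> M"
  shows "path_class M a = path_class M b \<longleftrightarrow> homotopic_paths M a b"
proof
  assume "path_class M a = path_class M b"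
  then have "a \<in> path_class M b"
    using assms by (auto simp: path_class_def)
  then show "homotopic_paths M a b"
    by (simp add: path_class_def homotopic_paths_sym)
next
  assume "homotopic_paths M a b"
  then show "path_class M a = path_class M b"
    unfolding path_class_def
    by (auto dest: homotopic_paths_trans homotopic_paths_trans[OF homotopic_paths_sym])
qed

text \<open>The product is a union over all choices of representatives. Concatenation respects
  homotopy, so all its terms are the same class, and the union over a nonempty family is that
  class.\<close>

lemma path_class_join:
  assumes "a \<in> based_loops M x" "b \<in> based_loops M x"
  shows "path_class M a \<otimes>\<^bsub>fundamental_group M x\<^esub> path_class M b = path_class M (a +++ b)"
proof -
  have ab: "path a" "path_image a \<subseteq> M" "path b" "path_image b \<subseteq> M" "pathfinish a = pathstart b"
    using assms by (auto simp: based_loops_def)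
  have *: "path_class M (a' +++ b') = path_class M (a +++ b)"
    if hom: "homotopic_paths M a a'" "homotopic_paths M b b'" for a' b'
  proof -
    have "path (a +++ b)" "path_image (a +++ b) \<subseteq> M"
      using ab by (auto simp: subset_path_image_join)
    then show ?thesis
      using homotopic_paths_join[OF hom ab(5)] path_class_eq[of "a +++ b" M "a' +++ b'"] by simp
  qed
  have "a \<in> path_class M a" "b \<in> path_class M b"
    using ab by (simp_all add: path_class_def)
  then have ne: "path_class M a \<noteq> {}" "path_class M b \<noteq> {}" by blast+
  have "(\<Union>a'\<in>path_class M a. \<Union>b'\<in>path_class M b. path_class M (a' +++ b')) =
      (\<Union>a'\<in>path_class M a. \<Union>b'\<in>path_class M b. path_class M (a +++ b))"
    by (intro SUP_cong refl *) (simp_all add: path_class_def)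
  then show ?thesis
    using ne by (simp add: fundamental_group_def)
qed

lemma based_loops_join: "a \<in> based_loops M x \<Longrightarrow> b \<in> based_loops M x \<Longrightarrow> a +++ b \<in> based_loops M x"
  by (auto simp: based_loops_def subset_path_image_join)

lemma based_loops_reversepath: "a \<in> based_loops M x \<Longrightarrow> reversepath a \<in> based_loops M x"
  by (auto simp: based_loops_def)

lemma based_loops_const: "x \<in> M \<Longrightarrow> (\<lambda>_. x) \<in> based_loops M x"
  by (auto simp: based_loops_def path_def path_image_def pathstart_def pathfinish_def)

lemma fundamental_group_simps:
  "carrier (fundamental_group M x) = path_class M ` based_loops M x"
  "\<one>\<^bsub>fundamental_group M x\<^esub> = path_class M (\<lambda>_. x)"
  by (simp_all add: fundamental_group_def)

lemma path_class_eq_based_loops: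
  "a \<in> based_loops M x \<Longrightarrow> path_class M a = path_class M b \<longleftrightarrow> homotopic_paths M a b"
  by (rule path_class_eq) (auto simp: based_loops_def)

lemma group_fundamental_group:
  assumes "x \<in> M"
  shows "group (fundamental_group M x)"
\<comment> \<open>Besides closure and associativity this rule asks for a left unit and left inverses
  only.\<close>
proof (rule groupI)
  let ?G = "fundamental_group M x"
  note loops = based_loops_join based_loops_reversepath based_loops_const[OF assms]
  show "\<alpha> \<otimes>\<^bsub>?G\<^esub> \<beta> \<in> carrier ?G" if "\<alpha> \<in> carrier ?G" "\<beta> \<in> carrier ?G" for \<alpha> \<beta>
    using that by (auto simp: fundamental_group_simps path_class_join intro!: imageI based_loops_join)
  show "\<one>\<^bsub>?G\<^esub> \<in> carrier ?G"
    using loops by (simp add: fundamental_group_simps)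
  show "\<alpha> \<otimes>\<^bsub>?G\<^esub> \<beta> \<otimes>\<^bsub>?G\<^esub> \<gamma> = \<alpha> \<otimes>\<^bsub>?G\<^esub> (\<beta> \<otimes>\<^bsub>?G\<^esub> \<gamma>)"
    if carr: "\<alpha> \<in> carrier ?G" "\<beta> \<in> carrier ?G" "\<gamma> \<in> carrier ?G" for \<alpha> \<beta> \<gamma>
  proof -
    obtain a b c where abc: "a \<in> based_loops M x" "b \<in> based_loops M x" "c \<in> based_loops M x"
      "\<alpha> = path_class M a" "\<beta> = path_class M b" "\<gamma> = path_class M c"
      using carr unfolding fundamental_group_simps by blast
    moreover have "path_class M (a +++ (b +++ c)) = path_class M ((a +++ b) +++ c)"
      using abc path_class_eq_based_loops[OF based_loops_join[OF abc(1) based_loops_join[OF abc(2,3)]]]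
      by (simp add: based_loops_def homotopic_paths_assoc)
    ultimately show ?thesis
      by (simp add: path_class_join loops)
  qed
  fix \<alpha> assume "\<alpha> \<in> carrier ?G"
  then obtain a where a: "a \<in> based_loops M x" "\<alpha> = path_class M a"
    unfolding fundamental_group_simps by blast
  then have p: "path a" "path_image a \<subseteq> M" "pathstart a = x" "pathfinish a = x"
    by (auto simp: based_loops_def)
  have "path_class M ((\<lambda>_. x) +++ a) = path_class M a"
    using homotopic_paths_const_left[OF p(1,2)] p
    by (simp add: path_class_eq_based_loops[OF based_loops_join[OF loops(3) a(1)]])
  then show "\<one>\<^bsub>?G\<^esub> \<otimes>\<^bsub>?G\<^esub> \<alpha> = \<alpha>"
    using a loops by (simp add: fundamental_group_simps path_class_join)
  have "path_class M (reversepath a +++ a) = path_class M (\<lambda>_. x)"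
    using homotopic_paths_reversepath_const[OF p(1,2)] p
    by (simp add: path_class_eq_based_loops[OF based_loops_join[OF loops(2) a(1)], OF a(1)])
  then show "\<exists>\<beta>\<in>carrier ?G. \<beta> \<otimes>\<^bsub>?G\<^esub> \<alpha> = \<one>\<^bsub>?G\<^esub>"
    using a loops by (auto simp: fundamental_group_simps path_class_join intro!: bexI[of _ "reversepath a"])
qed

section \<open>Homomorphisms induced by continuous maps\<close>

text \<open>As for products of classes, the union collapses: homotopic representatives have
  homotopic images.\<close>

lemma induced_map_path_class:
  assumes p: "continuous_on M' p" "p ` M' \<subseteq> M" and a: "path a" "path_image a \<subseteq> M'"
  shows "induced_map M p (path_class M' a) = path_class M (p \<circ> a)"
proof -
  have *: "path_class M (p \<circ> b) = path_class M (p \<circ> a)" if "homotopic_paths M' a b" for b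
  proof -
    have hom: "homotopic_paths M (p \<circ> a) (p \<circ> b)"
      using homotopic_paths_continuous_image[OF that p(1)] p(2) by (simp add: image_subset_iff_funcset)
    have "path (p \<circ> a)" "path_image (p \<circ> a) \<subseteq> M"
      using homotopic_paths_imp_path[OF hom] homotopic_paths_imp_subset[OF hom] by simp_all
    then show ?thesis
      using hom path_class_eq[of "p \<circ> a" M "p \<circ> b"] by simp
  qed
  have "a \<in> path_class M' a"
    using a by (simp add: path_class_def)
  then have ne: "path_class M' a \<noteq> {}" by blast
  have "induced_map M p (path_class M' a) = (\<Union>b\<in>path_class M' a. path_class M (p \<circ> a))"
    unfolding induced_map_def by (intro SUP_cong refl *) (simp add: path_class_def)
  then show ?thesis
    using ne by simp
qed

lemma based_loops_image:
  assumes "continuous_on M' p" "p ` M' \<subseteq> M" "a \<in> based_loops M' x"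
  shows "p \<circ> a \<in> based_loops M (p x)"
  using assms unfolding based_loops_def
  by (auto simp: path_image_compose pathstart_compose pathfinish_compose
      intro!: path_continuous_image intro: continuous_on_subset)

lemma group_hom_induced_map:
  assumes p: "continuous_on M' p" "p ` M' \<subseteq> M" and x: "x \<in> M'"
  shows "group_hom (fundamental_group M' x) (fundamental_group M (p x)) (induced_map M p)"
proof -
  have ind: "induced_map M p (path_class M' a) = path_class M (p \<circ> a)" if "a \<in> based_loops M' x" for a
    using induced_map_path_class[OF p] that by (simp add: based_loops_def)
  have "induced_map M p \<in> hom (fundamental_group M' x) (fundamental_group M (p x))"
    by (rule homI)
      (auto simp: fundamental_group_simps ind path_class_join based_loops_join path_compose_join
        based_loops_image[OF p])
  moreover have "p x \<in> M" using p x by blast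
  ultimately show ?thesis
    using x by (simp add: group_hom_def group_hom_axioms_def group_fundamental_group)
qed

section \<open>Index and divisibility under a homomorphism\<close>

text \<open>Choose representatives \<open>r\<close> of the cosets of the image of \<open>h\<close>
  and \<open>s\<close> of the cosets of \<open>N\<close>. Sending a pair of cosets to the coset of
  \<open>h (s Q) \<otimes> r R\<close> reaches every coset of the image of \<open>N\<close>.\<close>

lemma (in group_hom) card_rcosets_image_le:
  assumes N: "subgroup N G" "finite (rcosets\<^bsub>G\<^esub> N)"
    and K: "finite (rcosets\<^bsub>H\<^esub> (h ` carrier G))"
  shows "finite (rcosets\<^bsub>H\<^esub> (h ` N))"
    "card (rcosets\<^bsub>H\<^esub> (h ` N)) \<le> card (rcosets\<^bsub>H\<^esub> (h ` carrier G)) * card (rcosets\<^bsub>G\<^esub> N)"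
proof -
  have sK: "subgroup (h ` carrier G) H" and sN: "subgroup (h ` N) H"
    using N(1) G.subgroup_self by (blast intro: subgroup_img_is_subgroup)+
  have "\<exists>r. r \<in> carrier H \<and> R = h ` carrier G #>\<^bsub>H\<^esub> r" if "R \<in> rcosets\<^bsub>H\<^esub> (h ` carrier G)" for R
    using that unfolding RCOSETS_def by blast
  then obtain r where r: "\<And>R. R \<in> rcosets\<^bsub>H\<^esub> (h ` carrier G) \<Longrightarrow> r R \<in> carrier H"
    "\<And>R. R \<in> rcosets\<^bsub>H\<^esub> (h ` carrier G) \<Longrightarrow> R = h ` carrier G #>\<^bsub>H\<^esub> r R" by metis
  have "\<exists>s. s \<in> carrier G \<and> R = N #>\<^bsub>G\<^esub> s" if "R \<in> rcosets\<^bsub>G\<^esub> N" for R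
    using that unfolding RCOSETS_def by blast
  then obtain s where s: "\<And>R. R \<in> rcosets\<^bsub>G\<^esub> N \<Longrightarrow> s R \<in> carrier G"
    "\<And>R. R \<in> rcosets\<^bsub>G\<^esub> N \<Longrightarrow> R = N #>\<^bsub>G\<^esub> s R" by metis
  let ?A = "(rcosets\<^bsub>H\<^esub> (h ` carrier G)) \<times> (rcosets\<^bsub>G\<^esub> N)"
  let ?f = "\<lambda>(R, Q). h ` N #>\<^bsub>H\<^esub> (h (s Q) \<otimes>\<^bsub>H\<^esub> r R)"
  have sub: "rcosets\<^bsub>H\<^esub> (h ` N) \<subseteq> ?f ` ?A"
  proof
    fix X assume "X \<in> rcosets\<^bsub>H\<^esub> (h ` N)"
    then obtain a where a: "a \<in> carrier H" "X = h ` N #>\<^bsub>H\<^esub> a"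
      unfolding RCOSETS_def by blast
    define R where "R = h ` carrier G #>\<^bsub>H\<^esub> a"
    have R: "R \<in> rcosets\<^bsub>H\<^esub> (h ` carrier G)"
      using a unfolding R_def RCOSETS_def by blast
    have "a \<in> R" using H.rcos_self[OF a(1) sK] by (simp add: R_def)
    then obtain g where g: "g \<in> carrier G" "a = h g \<otimes>\<^bsub>H\<^esub> r R"
      using r(2)[OF R] unfolding r_coset_def by blast
    define Q where "Q = N #>\<^bsub>G\<^esub> g"
    have Q: "Q \<in> rcosets\<^bsub>G\<^esub> N"
      using g unfolding Q_def RCOSETS_def by blast
    have "g \<in> Q" using G.rcos_self[OF g(1) N(1)] by (simp add: Q_def)
    then obtain n where n: "n \<in> N" "g = n \<otimes>\<^bsub>G\<^esub> s Q"
      using s(2)[OF Q] unfolding r_coset_def by blast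
    have nG: "n \<in> carrier G" using n N(1) subgroup.mem_carrier by metis
    \<comment> \<open>The factor \<open>h n\<close> lies in the image of \<open>N\<close> and is
      absorbed by the coset; what remains depends only on \<open>R\<close> and
      \<open>Q\<close>.\<close>
    have "a = h n \<otimes>\<^bsub>H\<^esub> (h (s Q) \<otimes>\<^bsub>H\<^esub> r R)"
      using g n nG s(1)[OF Q] r(1)[OF R] by (simp add: H.m_assoc)
    moreover have "h ` N #>\<^bsub>H\<^esub> h n = h ` N"
      using H.coset_join2[OF _ sN] n nG by simp
    ultimately have "X = h ` N #>\<^bsub>H\<^esub> (h (s Q) \<otimes>\<^bsub>H\<^esub> r R)"
      using a H.coset_mult_assoc[OF subgroup.subset[OF sN], of "h n" "h (s Q) \<otimes>\<^bsub>H\<^esub> r R"]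
        nG s(1)[OF Q] r(1)[OF R] by simp
    then show "X \<in> ?f ` ?A" using Q R by force
  qed
  have fin: "finite ?A" using N K by simp
  show "finite (rcosets\<^bsub>H\<^esub> (h ` N))"
    using finite_subset[OF sub] fin by blast
  show "card (rcosets\<^bsub>H\<^esub> (h ` N)) \<le> card (rcosets\<^bsub>H\<^esub> (h ` carrier G)) * card (rcosets\<^bsub>G\<^esub> N)"
    using surj_card_le[OF fin sub] by (simp add: card_cartesian_product)
qed

lemma rcosets_nonempty: "group G \<Longrightarrow> rcosets\<^bsub>G\<^esub> H \<noteq> {}"
  unfolding RCOSETS_def using monoid.one_closed[OF group.is_monoid] by fastforce

lemma subgroup_index_ge_1: "group G \<Longrightarrow> 1 \<le> subgroup_index G H"
  using rcosets_nonempty[of G H]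
  by (auto simp: subgroup_index_def one_enat_def Suc_le_eq card_gt_0_iff)

lemma divisibility_ge_1: "group G \<Longrightarrow> 1 \<le> divisibility G g"
  unfolding divisibility_def by (auto intro!: INF_greatest subgroup_index_ge_1)

lemma divisibility_le: "subgroup H G \<Longrightarrow> g \<notin> H \<Longrightarrow> divisibility G g \<le> subgroup_index G H"
  unfolding divisibility_def by (rule INF_lower) simp

lemma (in group_hom) subgroup_index_image_le:
  assumes N: "subgroup N G"
  shows "subgroup_index H (h ` N) \<le> subgroup_index H (h ` carrier G) * subgroup_index G N"
proof (cases "finite (rcosets\<^bsub>G\<^esub> N) \<and> finite (rcosets\<^bsub>H\<^esub> (h ` carrier G))")
  case True
  then show ?thesis
    using card_rcosets_image_le[OF N] by (simp add: subgroup_index_def times_enat_simps)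
next
  case False
  \<comment> \<open>In \<open>enat\<close> zero times infinity is zero, so an infinite product needs
    both factors to be nonzero.\<close>
  have "subgroup_index H (h ` carrier G) \<noteq> 0" "subgroup_index G N \<noteq> 0"
    using subgroup_index_ge_1[OF H.is_group] subgroup_index_ge_1[OF G.is_group]
    by (metis not_one_le_zero)+
  moreover have "subgroup_index H (h ` carrier G) = \<infinity> \<or> subgroup_index G N = \<infinity>"
    using False by (auto simp: subgroup_index_def)
  ultimately have "subgroup_index H (h ` carrier G) * subgroup_index G N = \<infinity>"
    unfolding imult_is_infinity by blast
  then show ?thesis by simp
qed

text \<open>A subgroup \<open>N\<close> of least index that excludes \<open>g\<close> has an image
  that excludes \<open>h g\<close>, by injectivity, and the index of this image is controlled by the
  index of \<open>N\<close>.\<close>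

lemma (in group_hom) divisibility_image_le:
  assumes inj: "inj_on h (carrier G)" and g: "g \<in> carrier G"
  shows "divisibility H (h g) \<le> subgroup_index H (h ` carrier G) * divisibility G g"
proof (cases "{N. subgroup N G \<and> g \<notin> N} = {}")
  case True
  have "subgroup_index H (h ` carrier G) \<noteq> 0"
    using subgroup_index_ge_1[OF H.is_group] by (metis not_one_le_zero)
  \<comment> \<open>The infimum of the empty set in \<open>enat\<close> is infinity, which makes the
    bound trivial.\<close>
  moreover have "divisibility G g = \<infinity>"
    unfolding divisibility_def True by (simp add: top_enat_def)
  ultimately have "subgroup_index H (h ` carrier G) * divisibility G g = \<infinity>"
    unfolding imult_is_infinity by blast
  then show ?thesis by simp
next
  case False
  \<comment> \<open>The extended naturals are well-ordered, so the infimum of a nonempty set is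
    attained.\<close>
  then have "divisibility G g \<in> subgroup_index G ` {N. subgroup N G \<and> g \<notin> N}"
    unfolding divisibility_def using wellorder_InfI[of _ "subgroup_index G ` {N. subgroup N G \<and> g \<notin> N}"]
    by (metis (no_types, lifting) empty_is_image ex_in_conv)
  then obtain N where N: "subgroup N G" "g \<notin> N" "divisibility G g = subgroup_index G N"
    by blast
  have "h g \<notin> h ` N"
    using inj g N subgroup.subset[OF N(1)] by (auto dest: inj_onD)
  then have "divisibility H (h g) \<le> subgroup_index H (h ` N)"
    using N by (intro divisibility_le subgroup_img_is_subgroup)
  then show ?thesis
    using subgroup_index_image_le[OF N(1)] N(3) by simp
qed


section \<open>Geodesics in covering spaces\<close>


text \<open>Shrink a neighbourhood on which \<open>p\<close> is a homeomorphism to the part over the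
  chart domain. This provides a chart of the lifted atlas at \<open>y\<close> for every base chart
  at \<open>p y\<close>.\<close>

lemma covering_chart_domain:
  fixes p :: "'b::topological_space \<Rightarrow> 'a::topological_space" and c :: "('a, 'n::finite) rchart"
  assumes cov: "covering_space M' p M" and c: "y \<in> M'" "p y \<in> cdom c"
    and op: "openin (top_of_set M) (cdom c)"
  obtains V where "openin (top_of_set M') V" "inj_on p V" "p ` V \<subseteq> cdom c" "y \<in> V"
proof -
  obtain V U q where V: "y \<in> V" "openin (top_of_set M') V" "homeomorphism V U p q"
    using covering_space_local_homeomorphism[OF cov c(1)] by metis
  define W where "W = V \<inter> (M' \<inter> p -` cdom c)"
  have "openin (top_of_set M') W"
    unfolding W_def using cov op V(2)
    by (intro openin_Int continuous_openin_preimage[where T = M])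
      (auto simp: covering_space_def)
  moreover have "inj_on p V"
    using V(3) unfolding homeomorphism_def by (metis inj_onI)
  then have "inj_on p W"
    by (rule inj_on_subset) (simp add: W_def)
  moreover have "p ` W \<subseteq> cdom c" "y \<in> W"
    using c V by (auto simp: W_def)
  ultimately show ?thesis using that by blast
qed

lemma ball_lifted_atlas:
  "(\<forall>c\<in>lifted_atlas M' p A. P c) \<longleftrightarrow>
     (\<forall>V. \<forall>c\<in>A. openin (top_of_set M') V \<and> inj_on p V \<and> p ` V \<subseteq> cdom c \<longrightarrow>
        P (RChart V (cmap c \<circ> p) (cmet c)))"
  unfolding lifted_atlas_def by blast

lemma bex_lifted_atlas:
  "(\<exists>c\<in>lifted_atlas M' p A. P c) \<longleftrightarrow>
     (\<exists>V. \<exists>c\<in>A. openin (top_of_set M') V \<and> inj_on p V \<and> p ` V \<subseteq> cdom c \<and>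
        P (RChart V (cmap c \<circ> p) (cmet c)))"
  unfolding lifted_atlas_def by blast

lemma gip_RChart: "gip (RChart V f (cmet c)) = gip c"
  by (intro ext) (simp add: gip_def)

text \<open>A curve in a lifted chart has the same coordinates and metric coefficients as its
  projection in the base chart. So the two definite descriptions single out a number by equivalent
  conditions.\<close>

lemma riem_speed_lift:
  fixes p :: "'b::topological_space \<Rightarrow> 'a::topological_space" and A :: "('a, 'n::finite) rchart set"
  assumes cov: "covering_space M' p M" and op: "\<And>c. c \<in> A \<Longrightarrow> openin (top_of_set M) (cdom c)"
    and t: "\<gamma> t \<in> M'"
  shows "riem_speed (lifted_atlas M' p A) \<gamma> t = riem_speed A (p \<circ> \<gamma>) t"
proof -
  define F where "F c s \<longleftrightarrow> s = sqrt (gip c (cmap c (p (\<gamma> t)))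
      (vector_derivative (cmap c \<circ> (p \<circ> \<gamma>)) (at t)) (vector_derivative (cmap c \<circ> (p \<circ> \<gamma>)) (at t)))"
    for c :: "('a, 'n) rchart" and s
  have "(\<exists>c\<in>lifted_atlas M' p A. \<gamma> t \<in> cdom c \<and> s = sqrt (gip c (cmap c (\<gamma> t))
           (vector_derivative (cmap c \<circ> \<gamma>) (at t)) (vector_derivative (cmap c \<circ> \<gamma>) (at t)))) \<longleftrightarrow>
        (\<exists>c\<in>A. p (\<gamma> t) \<in> cdom c \<and> F c s)" (is "?L \<longleftrightarrow> ?R") for s
  proof -
    have "?L \<longleftrightarrow>
        (\<exists>V. \<exists>c\<in>A. openin (top_of_set M') V \<and> inj_on p V \<and> p ` V \<subseteq> cdom c \<and> \<gamma> t \<in> V \<and> F c s)"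
      unfolding bex_lifted_atlas by (simp add: F_def gip_RChart comp_assoc)
    also have "\<dots> \<longleftrightarrow> ?R"
    proof
      assume ?R
      then obtain c where c: "c \<in> A" "p (\<gamma> t) \<in> cdom c" "F c s" by blast
      obtain V where "openin (top_of_set M') V" "inj_on p V" "p ` V \<subseteq> cdom c" "\<gamma> t \<in> V"
        using covering_chart_domain[OF cov t c(2) op[OF c(1)]] by blast
      then show "\<exists>V. \<exists>c\<in>A. openin (top_of_set M') V \<and> inj_on p V \<and> p ` V \<subseteq> cdom c \<and> \<gamma> t \<in> V \<and> F c s"
        using c by blast
    qed blast
    finally show ?thesis .
  qed
  then show ?thesis
    unfolding riem_speed_def by (simp add: F_def)
qed

lemma riem_length_lift:
  fixes p :: "'b::topological_space \<Rightarrow> 'a::topological_space" and A :: "('a, 'n::finite) rchart set"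
  assumes cov: "covering_space M' p M" and op: "\<And>c. c \<in> A \<Longrightarrow> openin (top_of_set M) (cdom c)"
    and "range \<gamma> \<subseteq> M'"
  shows "riem_length (lifted_atlas M' p A) \<gamma> = riem_length A (p \<circ> \<gamma>)"
  unfolding riem_length_def
  using assms by (intro integral_cong riem_speed_lift[OF cov]) auto

lemma christoffel_RChart: "christoffel (RChart V f (cmet c)) = christoffel c"
  by (intro ext) (simp add: christoffel_def)

text \<open>The coordinate curve and the Christoffel symbols are unchanged by lifting, so the
  geodesic equations are literally the same. Lifted charts exist at every time at which the
  projected curve is in a base chart.\<close>

lemma geodesic_lift_iff:
  fixes p :: "'b::topological_space \<Rightarrow> 'a::topological_space" and A :: "('a, 'n::finite) rchart set"
  assumes cov: "covering_space M' p M" and op: "\<And>c. c \<in> A \<Longrightarrow> openin (top_of_set M) (cdom c)"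
    and \<gamma>: "continuous_on UNIV \<gamma>" "range \<gamma> \<subseteq> M'"
  shows "geodesic M' (lifted_atlas M' p A) \<gamma> \<longleftrightarrow> geodesic M A (p \<circ> \<gamma>)"
proof -
  define E where "E c x t \<longleftrightarrow> x differentiable (at t) \<and>
          ((\<lambda>s. vector_derivative x (at s)) has_vector_derivative
             (\<chi> k. - (\<Sum>i\<in>UNIV. \<Sum>j\<in>UNIV. christoffel c k i j (x t) *
               vector_derivative x (at t) $ i * vector_derivative x (at t) $ j))) (at t)"
    for c :: "('a, 'n) rchart" and x :: "real \<Rightarrow> real ^ 'n" and t
  have E: "geodesic M A \<delta> \<longleftrightarrow> continuous_on UNIV \<delta> \<and> range \<delta> \<subseteq> M \<and>
     (\<forall>c\<in>A. \<forall>t. \<delta> t \<in> cdom c \<longrightarrow> E c (cmap c \<circ> \<delta>) t)" for \<delta>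
    by (simp add: geodesic_def E_def Let_def)
  have "geodesic M' (lifted_atlas M' p A) \<gamma> \<longleftrightarrow>
     (\<forall>V. \<forall>c\<in>A. openin (top_of_set M') V \<and> inj_on p V \<and> p ` V \<subseteq> cdom c \<longrightarrow>
        (\<forall>t. \<gamma> t \<in> V \<longrightarrow> E c (cmap c \<circ> (p \<circ> \<gamma>)) t))"
    using \<gamma> unfolding geodesic_def ball_lifted_atlas by (simp add: E_def Let_def christoffel_RChart comp_assoc)
  also have "\<dots> \<longleftrightarrow> (\<forall>c\<in>A. \<forall>t. p (\<gamma> t) \<in> cdom c \<longrightarrow> E c (cmap c \<circ> (p \<circ> \<gamma>)) t)" (is "?L \<longleftrightarrow> ?R")
  proof
    assume L: ?L
    show ?R
    proof (intro ballI allI impI)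
      fix c t assume c: "c \<in> A" "p (\<gamma> t) \<in> cdom c"
      then obtain V where "openin (top_of_set M') V" "inj_on p V" "p ` V \<subseteq> cdom c" "\<gamma> t \<in> V"
        using covering_chart_domain[OF cov _ c(2) op[OF c(1)]] \<gamma>(2) by blast
      then show "E c (cmap c \<circ> (p \<circ> \<gamma>)) t" using L c by blast
    qed
  qed blast
  also have "\<dots> \<longleftrightarrow> geodesic M A (p \<circ> \<gamma>)"
  proof -
    have "continuous_on UNIV (p \<circ> \<gamma>)"
      using continuous_on_compose[OF \<gamma>(1) continuous_on_subset[OF covering_space_imp_continuous[OF cov] \<gamma>(2)]] .
    moreover have "range (p \<circ> \<gamma>) \<subseteq> M"
      using covering_space_imp_surjective[OF cov] \<gamma>(2) by auto
    ultimately show ?thesis by (simp add: E)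
  qed
  finally show ?thesis .
qed

lemma geodesic_rep_induced_map:
  fixes p :: "'b::topological_space \<Rightarrow> 'a::topological_space" and A :: "('a, 'n::finite) rchart set"
  assumes cov: "covering_space M' p M" and a: "a \<in> based_loops M' x"
    and rep: "geodesic_rep M' (lifted_atlas M' p A) (path_class M' a) \<gamma>"
    and op: "\<And>c. c \<in> A \<Longrightarrow> openin (top_of_set M) (cdom c)"
  shows "geodesic_rep M A (path_class M (p \<circ> a)) (p \<circ> \<gamma>)"
    "riem_length A (p \<circ> \<gamma>) = riem_length (lifted_atlas M' p A) \<gamma>"
proof -
  have p: "continuous_on M' p" "p ` M' \<subseteq> M"
    using cov by (auto simp: covering_space_def)
  obtain b where b: "homotopic_paths M' a b" "homotopic_loops M' b \<gamma>"
    using rep by (auto simp: geodesic_rep_def path_class_def)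
  have \<gamma>: "geodesic M' (lifted_atlas M' p A) \<gamma>" "\<And>t. \<gamma> (t + 1) = \<gamma> t"
    using rep by (auto simp: geodesic_rep_def closed_geodesic_def)
  then have \<gamma>': "continuous_on UNIV \<gamma>" "range \<gamma> \<subseteq> M'"
    by (simp_all add: geodesic_def)
  show "geodesic_rep M A (path_class M (p \<circ> a)) (p \<circ> \<gamma>)"
    unfolding geodesic_rep_def closed_geodesic_def
  proof (intro conjI allI bexI)
    show "geodesic M A (p \<circ> \<gamma>)"
      using geodesic_lift_iff[OF cov op \<gamma>'] \<gamma>(1) by blast
    show "homotopic_loops M (p \<circ> b) (p \<circ> \<gamma>)"
      using homotopic_loops_continuous_image[OF b(2) p(1)] p(2) by (simp add: image_subset_iff_funcset)
    show "p \<circ> b \<in> path_class M (p \<circ> a)"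
      using homotopic_paths_continuous_image[OF b(1) p(1)] p(2)
      by (simp add: image_subset_iff_funcset path_class_def)
  qed (simp add: \<gamma>(2))
  show "riem_length A (p \<circ> \<gamma>) = riem_length (lifted_atlas M' p A) \<gamma>"
    using riem_length_lift[OF cov op \<gamma>'(2)] by simp
qed

section \<open>Lifting geodesic representatives\<close>

text \<open>Lifting a homotopy yields a loop over the unit interval only, whereas a closed geodesic
  lives on the whole line. The lift is therefore repeated with period 1.\<close>

lemma periodic_lift:
  fixes \<gamma> :: "real \<Rightarrow> 'a" and \<delta> :: "real \<Rightarrow> 'b::topological_space"
  assumes \<delta>: "path \<delta>" "path_image \<delta> \<subseteq> M'" "pathfinish \<delta> = pathstart \<delta>"
    and p\<delta>: "\<And>t. t \<in> {0..1} \<Longrightarrow> p (\<delta> t) = \<gamma> t" and \<gamma>: "\<And>t. \<gamma> (t + 1) = \<gamma> t"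
  obtains \<gamma>' where "continuous_on UNIV \<gamma>'" "range \<gamma>' \<subseteq> M'" "p \<circ> \<gamma>' = \<gamma>"
    "\<And>t. t \<in> {0..1} \<Longrightarrow> \<gamma>' t = \<delta> t" "\<And>t. \<gamma>' (t + 1) = \<gamma>' t"
proof
  define \<gamma>' where "\<gamma>' t = \<delta> (frac t)" for t
  have per: "\<gamma>' (t + 1) = \<gamma>' t" for t
    unfolding \<gamma>'_def by (simp add: frac_def)
  \<comment> \<open>The right end point is included: there the fractional part drops to 0, and the
    formula survives because \<open>\<delta>\<close> is closed.\<close>
  have ext: "\<gamma>' t = \<delta> (t - of_int k)" if "t \<in> {of_int k..of_int k + 1}" for t and k :: int
  proof (cases "t = of_int k + 1")
    case True
    then show ?thesis
      using \<delta>(3) by (simp add: \<gamma>'_def pathfinish_def pathstart_def)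
  next
    case False
    then have "\<lfloor>t\<rfloor> = k" using that by (simp add: floor_eq_iff)
    then show ?thesis by (simp add: \<gamma>'_def frac_def)
  qed
  have c\<delta>: "continuous_on {0..1} \<delta>" using \<delta>(1) by (simp add: path_def)
  have "continuous_on {of_int k..of_int k + 1} \<gamma>'" for k :: int
  proof -
    have "continuous_on {of_int k..of_int k + 1} (\<lambda>t. \<delta> (t - of_int k))"
      by (rule continuous_on_compose2[OF c\<delta>]) (auto intro!: continuous_intros)
    then show ?thesis by (rule continuous_on_eq) (simp add: ext)
  qed
  note ck = this
  show "continuous_on UNIV \<gamma>'"
  proof (rule continuous_at_imp_continuous_on, rule ballI)
    fix t :: real
    define k where "k = \<lfloor>t\<rfloor>"
    \<comment> \<open>Two adjacent unit intervals are needed, because \<open>t\<close> may be an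
      integer and must be an interior point.\<close>
    have "continuous_on ({of_int (k - 1)..of_int (k - 1) + 1} \<union> {of_int k..of_int k + 1}) \<gamma>'"
      by (intro continuous_on_closed_Un ck) auto
    moreover have "{of_int (k - 1)..of_int (k - 1) + 1} \<union> {of_int k..of_int k + 1} = {of_int k - 1..of_int k + (1::real)}"
      by auto
    moreover have "t \<in> interior {of_int k - 1..of_int k + (1::real)}"
      unfolding k_def by simp linarith
    ultimately show "isCont \<gamma>' t"
      by (metis continuous_on_interior)
  qed
  have fr: "frac t \<in> {0..1}" for t :: real
    using frac_lt_1[of t] by simp
  show "range \<gamma>' \<subseteq> M'"
    using \<delta>(2) fr by (auto simp: \<gamma>'_def path_image_def)
  have shift: "\<gamma> (t + of_int k) = \<gamma> t" for t k
  proof (induction k rule: int_induct[of _ 0])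
    case (step1 i)
    then show ?case using \<gamma>[of "t + of_int i"] by (simp add: add.assoc)
  next
    case (step2 i)
    then show ?case using \<gamma>[of "t + of_int i - 1"] by (simp add: algebra_simps)
  qed simp
  have "\<gamma> (frac t) = \<gamma> t" for t
    using shift[of "frac t" "\<lfloor>t\<rfloor>"] by (simp add: frac_def)
  then show "p \<circ> \<gamma>' = \<gamma>"
    using p\<delta>[OF fr] by (auto simp: \<gamma>'_def)
  show "\<gamma>' t = \<delta> t" if "t \<in> {0..1}" for t
    using ext[of t 0] that by simp
  show "\<gamma>' (t + 1) = \<gamma>' t" for t by (rule per)
qed

text \<open>The free homotopy from \<open>p \<circ> a\<close> to the geodesic lifts to one that
  starts at the closed loop \<open>a\<close>. Its final loop, extended periodically, lies over the
  geodesic and so is a geodesic itself.\<close>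

lemma geodesic_rep_lift:
  fixes p :: "'b::topological_space \<Rightarrow> 'a::topological_space" and A :: "('a, 'n::finite) rchart set"
  assumes cov: "covering_space M' p M" and a: "a \<in> based_loops M' x"
    and rep: "geodesic_rep M A (path_class M (p \<circ> a)) \<gamma>"
    and op: "\<And>c. c \<in> A \<Longrightarrow> openin (top_of_set M) (cdom c)"
  obtains \<gamma>' where "geodesic_rep M' (lifted_atlas M' p A) (path_class M' a) \<gamma>'" "p \<circ> \<gamma>' = \<gamma>"
proof -
  obtain b where b: "homotopic_paths M (p \<circ> a) b" "homotopic_loops M b \<gamma>"
    using rep by (auto simp: geodesic_rep_def path_class_def)
  have \<gamma>: "geodesic M A \<gamma>" "\<And>t. \<gamma> (t + 1) = \<gamma> t"
    using rep by (auto simp: geodesic_rep_def closed_geodesic_def)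
  have aM: "path a" "path_image a \<subseteq> M'" "pathfinish a = pathstart a"
    using a by (auto simp: based_loops_def)
  have "homotopic_loops M (p \<circ> a) b"
    using homotopic_paths_imp_homotopic_loops[OF b(1)] homotopic_paths_imp_pathfinish[OF b(1)] aM(3)
    by (simp add: pathfinish_compose pathstart_compose)
  then have "homotopic_loops M (p \<circ> a) \<gamma>"
    using b(2) homotopic_loops_trans by blast
  then obtain \<delta> where \<delta>: "homotopic_loops M' a \<delta>" "\<And>t. t \<in> {0..1} \<Longrightarrow> p (\<delta> t) = \<gamma> t"
    using covering_lift_homotopic_loops[OF cov _ aM] by metis
  have \<delta>p: "path \<delta>" "path_image \<delta> \<subseteq> M'" "pathfinish \<delta> = pathstart \<delta>"
    using homotopic_loops_imp_path[OF \<delta>(1)] homotopic_loops_imp_subset[OF \<delta>(1)]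
      homotopic_loops_imp_loop[OF \<delta>(1)] by simp_all
  obtain \<gamma>' where \<gamma>': "continuous_on UNIV \<gamma>'" "range \<gamma>' \<subseteq> M'" "p \<circ> \<gamma>' = \<gamma>"
    "\<And>t. t \<in> {0..1} \<Longrightarrow> \<gamma>' t = \<delta> t" "\<And>t. \<gamma>' (t + 1) = \<gamma>' t"
    using periodic_lift[of \<delta> M' p \<gamma>, OF \<delta>p \<delta>(2) \<gamma>(2)] by metis
  have "homotopic_loops M' \<delta> \<gamma>'"
    by (rule homotopic_loops_eq[OF \<delta>p]) (simp add: \<gamma>'(4))
  then have hom: "homotopic_loops M' a \<gamma>'"
    using homotopic_loops_trans[OF \<delta>(1)] by blast
  have "geodesic M' (lifted_atlas M' p A) \<gamma>'"
    using geodesic_lift_iff[OF cov op \<gamma>'(1,2)] \<gamma>(1) \<gamma>'(3) by simp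
  moreover have "a \<in> path_class M' a"
    using aM by (simp add: path_class_def)
  ultimately have "geodesic_rep M' (lifted_atlas M' p A) (path_class M' a) \<gamma>'"
    using hom \<gamma>'(5) by (auto simp: geodesic_rep_def closed_geodesic_def)
  then show ?thesis using \<gamma>'(3) that by blast
qed

text \<open>Phrased for an arbitrary number \<open>l\<close> so as to match the conditions that
  define \<open>geodesic_length\<close> upstairs and downstairs.\<close>

lemma geodesic_rep_length_lift_iff:
  fixes p :: "'b::topological_space \<Rightarrow> 'a::topological_space" and A :: "('a, 'n::finite) rchart set"
  assumes cov: "covering_space M' p M" and a: "a \<in> based_loops M' x"
    and op: "\<And>c. c \<in> A \<Longrightarrow> openin (top_of_set M) (cdom c)"
  shows "(\<exists>\<gamma>. geodesic_rep M' (lifted_atlas M' p A) (path_class M' a) \<gamma> \<and>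
             l = riem_length (lifted_atlas M' p A) \<gamma>) \<longleftrightarrow>
         (\<exists>\<gamma>. geodesic_rep M A (path_class M (p \<circ> a)) \<gamma> \<and> l = riem_length A \<gamma>)"
  (is "?L \<longleftrightarrow> ?R")
proof
  assume ?L
  then show ?R using geodesic_rep_induced_map[OF cov a _ op] by metis
next
  assume ?R
  then obtain \<gamma> where \<gamma>: "geodesic_rep M A (path_class M (p \<circ> a)) \<gamma>" "l = riem_length A \<gamma>"
    by blast
  obtain \<gamma>' where "geodesic_rep M' (lifted_atlas M' p A) (path_class M' a) \<gamma>'" "p \<circ> \<gamma>' = \<gamma>"
    using geodesic_rep_lift[OF cov a \<gamma>(1) op] by blast
  then show ?L using geodesic_rep_induced_map(2)[OF cov a _ op] \<gamma>(2) by metis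
qed

lemma short_classes_lift:
  fixes p :: "'b::topological_space \<Rightarrow> 'a::topological_space" and A :: "('a, 'n::finite) rchart set"
  assumes cov: "covering_space M' p M" and x: "x \<in> M'"
    and op: "\<And>c. c \<in> A \<Longrightarrow> openin (top_of_set M) (cdom c)"
    and \<alpha>: "\<alpha> \<in> carrier (fundamental_group M' x)" "induced_map M p \<alpha> \<in> short_classes M A (p x) n"
  shows "\<alpha> \<in> short_classes M' (lifted_atlas M' p A) x n"
proof -
  have p: "continuous_on M' p" "p ` M' \<subseteq> M"
    using cov by (auto simp: covering_space_def)
  interpret group_hom "fundamental_group M' x" "fundamental_group M (p x)" "induced_map M p"
    by (rule group_hom_induced_map[OF p x])
  obtain a where a: "a \<in> based_loops M' x" "\<alpha> = path_class M' a"
    using \<alpha>(1) unfolding fundamental_group_simps by blast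
  have ind: "induced_map M p \<alpha> = path_class M (p \<circ> a)"
    using a induced_map_path_class[OF p] by (simp add: based_loops_def)
  have iff: "(\<exists>\<gamma>. geodesic_rep M' (lifted_atlas M' p A) (path_class M' a) \<gamma> \<and>
             l = riem_length (lifted_atlas M' p A) \<gamma>) \<longleftrightarrow>
         (\<exists>\<gamma>. geodesic_rep M A (path_class M (p \<circ> a)) \<gamma> \<and> l = riem_length A \<gamma>)" for l
    using geodesic_rep_length_lift_iff[OF cov a(1)] op by blast
  have "geodesic_length M' (lifted_atlas M' p A) (path_class M' a) = geodesic_length M A (path_class M (p \<circ> a))"
    unfolding geodesic_length_def iff ..
  then have "geodesic_length M' (lifted_atlas M' p A) \<alpha> = geodesic_length M A (induced_map M p \<alpha>)"
    using ind a(2) by simp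
  moreover obtain \<gamma> where "geodesic_rep M A (path_class M (p \<circ> a)) \<gamma>"
    using \<alpha>(2) ind by (auto simp: short_classes_def)
  then have "\<exists>\<gamma>. geodesic_rep M' (lifted_atlas M' p A) \<alpha> \<gamma>"
    unfolding a(2) by (rule geodesic_rep_lift[OF cov a(1) _ op]) blast+
  \<comment> \<open>A homomorphism would send the trivial class to the trivial class, which is not a
    short class.\<close>
  moreover have "\<alpha> \<noteq> \<one>\<^bsub>fundamental_group M' x\<^esub>"
    using \<alpha>(2) by (auto simp: short_classes_def)
  ultimately show ?thesis
    using \<alpha> by (simp add: short_classes_def)
qed

text \<open>Representatives in the cover start at the same point, so a homotopy between their images
  lifts to one between them.\<close>

lemma inj_on_induced_map:
  assumes cov: "covering_space M' p M"
  shows "inj_on (induced_map M p) (carrier (fundamental_group M' x))"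
proof (rule inj_onI)
  fix \<alpha> \<beta> assume "\<alpha> \<in> carrier (fundamental_group M' x)" "\<beta> \<in> carrier (fundamental_group M' x)"
    and eq: "induced_map M p \<alpha> = induced_map M p \<beta>"
  then obtain a b where ab: "a \<in> based_loops M' x" "\<alpha> = path_class M' a"
    "b \<in> based_loops M' x" "\<beta> = path_class M' b"
    unfolding fundamental_group_simps by blast
  have p: "continuous_on M' p" "p ` M' \<subseteq> M"
    using cov by (auto simp: covering_space_def)
  have "path_class M (p \<circ> a) = path_class M (p \<circ> b)"
    using eq ab induced_map_path_class[OF p] by (simp add: based_loops_def)
  then have "homotopic_paths M (p \<circ> a) (p \<circ> b)"
    using path_class_eq_based_loops[OF based_loops_image[OF p ab(1)]] by blast
  then have "homotopic_paths M' a b"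
    using covering_lift_homotopic_paths[OF cov] ab by (auto simp: based_loops_def)
  then show "\<alpha> = \<beta>"
    using ab path_class_eq_based_loops by blast
qed

section \<open>Bounds on the geodesic residual finiteness function\<close>

lemma geodesic_RF_ge_1:
  assumes "x \<in> M"
  shows "1 \<le> geodesic_RF M A x n"
  unfolding geodesic_RF_def
  using divisibility_ge_1[OF group_fundamental_group[OF assms]] by (auto intro: SUP_upper2)

lemma divisibility_le_geodesic_RF:
  "\<alpha> \<in> short_classes M A x n \<Longrightarrow> divisibility (fundamental_group M x) \<alpha> \<le> geodesic_RF M A x n"
  unfolding geodesic_RF_def by (auto intro: SUP_upper)

text \<open>Needed for the growth comparison, where the argument on the right is rescaled. If no
  class is short for \<open>m\<close>, the value there is the default 1, the least possible
  one.\<close>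

lemma geodesic_RF_mono:
  assumes "x \<in> M" "m \<le> n"
  shows "geodesic_RF M A x m \<le> geodesic_RF M A x n"
proof (cases "short_classes M A x m = {}")
  case True
  then have "geodesic_RF M A x m = 1"
    by (simp add: geodesic_RF_def)
  then show ?thesis
    using geodesic_RF_ge_1[OF assms(1)] by metis
next
  case False
  have "short_classes M A x m \<subseteq> short_classes M A x n"
    using assms(2) by (auto simp: short_classes_def)
  then show ?thesis
    using False by (auto simp: geodesic_RF_def intro: SUP_subset_mono)
qed

theorem lemma5p1:
  fixes M :: "'a::topological_space set" and A :: "('a, 'n::finite) rchart set" and x :: 'a
    and M' :: "'b::topological_space set" and p :: "'b \<Rightarrow> 'a" and x' :: 'b
    and K :: "(real \<Rightarrow> 'a) set set" and C :: nat
  assumes "hyperbolic_manifold M A" and "x \<in> M"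
    and "subgroup K (fundamental_group M x)"
    and "subgroup_index (fundamental_group M x) K = enat C"
    and "connected M'" and "covering_space M' p M" and "x' \<in> M'" and "p x' = x"
    and "induced_map M p ` carrier (fundamental_group M' x') = K"
  shows "(\<forall>n::real. n > 0 \<longrightarrow>
            geodesic_RF M A x n \<le> enat C * geodesic_RF M' (lifted_atlas M' p A) x' n)
       \<and> geodesic_RF M A x \<preceq> geodesic_RF M' (lifted_atlas M' p A) x'"
proof -
  let ?G = "fundamental_group M x" and ?G' = "fundamental_group M' x'"
  let ?A' = "lifted_atlas M' p A"
  let ?F = "geodesic_RF M A x" and ?F' = "geodesic_RF M' ?A' x'"
  note cov = \<open>covering_space M' p M\<close> and index = \<open>subgroup_index ?G K = enat C\<close>
  have op: "openin (top_of_set M) (cdom c)" if "c \<in> A" for c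
    using assms(1) that by (auto simp: hyperbolic_manifold_def riem_manifold_def riem_chart_def)
  have p: "continuous_on M' p" "p ` M' \<subseteq> M"
    using cov by (auto simp: covering_space_def)
  interpret group_hom ?G' ?G "induced_map M p"
    using group_hom_induced_map[OF p \<open>x' \<in> M'\<close>] \<open>p x' = x\<close> by simp
  have F': "1 \<le> ?F' n" for n
    by (rule geodesic_RF_ge_1[OF \<open>x' \<in> M'\<close>])
  have "1 \<le> enat C"
    using subgroup_index_ge_1[OF H.is_group, of K] index by simp
  then have C: "C \<ge> 1"
    by (simp add: one_enat_def)
  have bound: "divisibility ?G \<alpha> \<le> enat C * ?F' n" if \<alpha>: "\<alpha> \<in> short_classes M A x n" for \<alpha> n
  proof (cases "\<alpha> \<in> K")
    case True
    then obtain \<beta> where \<beta>: "\<beta> \<in> carrier ?G'" "\<alpha> = induced_map M p \<beta>"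
      using assms(9) by blast
    have "\<beta> \<in> short_classes M' ?A' x' n"
      using short_classes_lift[OF cov \<open>x' \<in> M'\<close> op \<beta>(1)] \<alpha> \<beta>(2) \<open>p x' = x\<close> by simp
    then have "divisibility ?G' \<beta> \<le> ?F' n"
      by (rule divisibility_le_geodesic_RF)
    \<comment> \<open>The image of the whole group of the cover is \<open>K\<close>, so the index
      that occurs as a factor is \<open>C\<close>.\<close>
    moreover have "divisibility ?G \<alpha> \<le> enat C * divisibility ?G' \<beta>"
      using divisibility_image_le[OF inj_on_induced_map[OF cov] \<beta>(1)] \<beta>(2) assms(9) index by simp
    ultimately show ?thesis
      by (meson mult_left_mono order_trans zero_le)
  next
    case False
    \<comment> \<open>Here \<open>K\<close> itself excludes the class; the factor 1 is then replaced
      by the function of the cover, which is at least 1.\<close>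
    then have "divisibility ?G \<alpha> \<le> enat C * 1"
      using divisibility_le[OF assms(3)] index by simp
    also have "\<dots> \<le> enat C * ?F' n"
      using F' by (rule mult_left_mono) simp
    finally show ?thesis .
  qed
  have main: "?F n \<le> enat C * ?F' n" for n
  proof (cases "short_classes M A x n = {}")
    case True
    \<comment> \<open>With no short classes the left side is the default 1, and both factors on the
      right are at least 1.\<close>
    have "1 * 1 \<le> enat C * ?F' n"
      using \<open>1 \<le> enat C\<close> F' by (rule mult_mono) simp_all
    then show ?thesis using True by (simp add: geodesic_RF_def)
  next
    case False
    then have "?F n = (SUP \<alpha>\<in>short_classes M A x n. divisibility ?G \<alpha>)"
      by (simp add: geodesic_RF_def)
    also have "\<dots> \<le> enat C * ?F' n"
      by (intro SUP_least bound)
    finally show ?thesis .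
  qed
  have "?F \<preceq> ?F'"
    unfolding growth_le_def
  \<comment> \<open>The index serves as the constant in both places: as a factor by the bound just
    shown, and inside the argument by monotonicity since \<open>C \<ge> 1\<close>.\<close>
  proof (intro exI[of _ "real C"] conjI allI impI)
    show "0 < real C" using C by simp
    fix n :: nat
    have "real n \<le> real C * real n"
      using C by (simp add: mult_le_cancel_right1)
    then have "?F (real n) \<le> enat C * ?F' (real C * real n)"
      using main[of "real n"] geodesic_RF_mono[OF \<open>x' \<in> M'\<close>]
      by (meson mult_left_mono order_trans zero_le)
    then have "ereal_of_enat (?F (real n)) \<le> ereal_of_enat (enat C * ?F' (real C * real n))"
      by simp
    then show "ereal_of_enat (?F (real n)) \<le> ereal (real C) * ereal_of_enat (?F' (real C * real n))"
      by (simp add: ereal_of_enat_mult)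
  qed
  then show ?thesis using main by blast
qed

end
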